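(* Let $\gamma$ be a translation-invariant (nonnull) specification on $(\Omega,\mathcal F)$ and let $\nu\in\mathcal G_{\mathrm{inv}}(\gamma)$. Then for every $\mu\in\mathcal M^+_{1,\mathrm{inv}}$: if $h(\mu|\nu)$ exists and equals $0$ and $\mu(\Omega_\gamma)=1$, then $\mu\in\mathcal G_{\mathrm{inv}}(\gamma)$ (and thus $\mu$ is almost Gibbs with respect to $\gamma$).
   Context: Let $E$ be a finite set, $\Omega=E^{\mathbb Z^d}$ with product topology and Borel $\sigma$-field $\mathcal F$. For $\Lambda\subset\mathbb Z^d$, $\mathcal F_\Lambda$ is the $\sigma$-field generated by the coordinates in $\Lambda$; $\mathcal S$ denotes the finite subsets of $\mathbb Z^d$; $\sigma_\Lambda\omega_{\Lambda^c}$ is the configuration equal to $\sigma$ on $\Lambda$ and to $\omega$ off $\Lambda$; for a measure $\mu$, $\mu(\sigma_\Lambda)=\mu(\{\omega:\omega_\Lambda=\sigma_\Lambda\})$. A function is local if it is $\mathcal F_\Delta$-measurable for some finite $\Delta$. Translations: $(\tau_x\omega)(y)=\omega(x+y)$; $\mathcal M^+_{1,\mathrm{inv}}$ is the set of translation-invariant probability measures on $\Omega$. A specification $\gamma=(\gamma_\Lambda)_{\Lambda\in\mathcal S}$ is a family of probability kernels $\gamma_\Lambda(\cdot|\omega)$ on $(\Omega,\mathcal F)$, with $\gamma_\Lambda(A|\cdot)$ $\mathcal F_{\Lambda^c}$-measurable, that are proper ($\gamma_\Lambda(B|\omega)=1_B(\omega)$ for all $B\in\mathcal F_{\Lambda^c}$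 and all $\omega$) and consistent ($\int\gamma_\Lambda(A|\omega')\gamma_{\Lambda'}(d\omega'|\omega)=\gamma_{\Lambda'}(A|\omega)$ for all finite $\Lambda\subset\Lambda'$, all $A\in\mathcal F$, all $\omega$). Specifications are assumed nonnull: for each $\Lambda$ there are $0<a_\Lambda<b_\Lambda<1$ with $a_\Lambda<\inf_{\sigma,\eta}\gamma_\Lambda(\sigma_\Lambda|\eta)\le\sup_{\sigma,\eta}\gamma_\Lambda(\sigma_\Lambda|\eta)<b_\Lambda$, where $\gamma_\Lambda(\sigma_\Lambda|\eta)=\gamma_\Lambda(\{\omega:\omega_\Lambda=\sigma_\Lambda\}|\eta)$. $\gamma$ is translation-invariant if $\gamma_{\Lambda+x}(A|\omega)=\gamma_\Lambda(\tau_xA|\tau_x\omega)$ for all $\Lambda,x,A,\omega$. A probability measure $\mu$ is in $\mathcal G(\gamma)$ if for all $\Lambda\in\mathcal S$ and $A\in\mathcal F$, $\mu(A|\mathcal F_{\Lambda^c})(\omega)=\gamma_\Lambda(A|\omega)$ for $\mu$-a.e. $\omega$; $\mathcal G_{\mathrm{inv}}(\gamma)=\mathcal G(\gamma)\cap\mathcal M^+_{1,\mathrm{inv}}$. A configuration $\omega$ is a point of continuity of $\gamma$ if for every $\Lambda\in\mathcal S$ and every local $f$, the function $\omega'\mapsto\int f(\sigma)\gamma_\Lambda(d\sigma|\omega')$ is continuous at $\omega$; $\Omega_\gamma$ is the set of points of continuity. A measure is almost Gibbs w.r.t. $\gamma$ if it lies in $\mathcal G(\gamma)$ and gives full measure to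 $\Omega_\gamma$. Relative entropy: with $\Lambda_n=[-n,n]^d\cap\mathbb Z^d$, $h_\Lambda(\mu|\nu)=\sum_{\sigma_\Lambda\in E^\Lambda}\mu(\sigma_\Lambda)\log\frac{\mu(\sigma_\Lambda)}{\nu(\sigma_\Lambda)}$ (set to $+\infty$ if $\mu_\Lambda$ is not absolutely continuous w.r.t. $\nu_\Lambda$), and $h(\mu|\nu)=\lim_{n\to\infty}|\Lambda_n|^{-1}h_{\Lambda_n}(\mu|\nu)$ whenever the limit exists. *)

theory Defs
  imports "HOL-Probability.Probability"
begin

text \<open>Configuration space Omega = E^(Z^d), sites of type int^'d, spins of a finite type 'e.
  The sigma-field is the product sigma-field of the discrete spaces (equal to the Borel
  sigma-field of the product topology, since the index set is countable and E finite).\<close>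

definition Omega :: "('s \<Rightarrow> 'e) measure" where
  "Omega = PiM UNIV (\<lambda>_. count_space UNIV)"

definition Fsub :: "'s set \<Rightarrow> ('s \<Rightarrow> 'e) measure" where
  "Fsub \<Lambda> = sigma UNIV {{\<omega>. \<omega> x = a} | x a. x \<in> \<Lambda>}"

definition Omega_top :: "('s \<Rightarrow> 'e) topology" where
  "Omega_top = product_topology (\<lambda>_. discrete_topology UNIV) UNIV"

definition cyl :: "'s set \<Rightarrow> ('s \<Rightarrow> 'e) \<Rightarrow> ('s \<Rightarrow> 'e) set" where
  "cyl \<Lambda> \<sigma> = {\<omega>. \<forall>x\<in>\<Lambda>. \<omega> x = \<sigma> x}"

definition configs :: "'s set \<Rightarrow> ('s \<Rightarrow> 'e) set" where
  "configs \<Lambda> = PiE \<Lambda> (\<lambda>_. UNIV)"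

definition shift :: "'s::plus \<Rightarrow> ('s \<Rightarrow> 'e) \<Rightarrow> ('s \<Rightarrow> 'e)" where
  "shift x \<omega> = (\<lambda>y. \<omega> (x + y))"

text \<open>Specification: gamma Lambda omega is the probability measure gamma_Lambda(.|omega)
  (only meaningful for finite Lambda).\<close>
definition is_spec :: "('s set \<Rightarrow> ('s \<Rightarrow> 'e) \<Rightarrow> ('s \<Rightarrow> 'e) measure) \<Rightarrow> bool" where
  "is_spec \<gamma> \<longleftrightarrow>
     (\<forall>\<Lambda>. finite \<Lambda> \<longrightarrow>
        (\<forall>\<omega>. prob_space (\<gamma> \<Lambda> \<omega>) \<and> sets (\<gamma> \<Lambda> \<omega>) = sets Omega) \<and>
        (\<forall>A\<in>sets Omega. (\<lambda>\<omega>. measure (\<gamma> \<Lambda> \<omega>) A) \<in> borel_measurable (Fsub (- \<Lambda>))) \<and>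
        (\<forall>B\<in>sets (Fsub (- \<Lambda>)). \<forall>\<omega>. measure (\<gamma> \<Lambda> \<omega>) B = indicator B \<omega>)) \<and>
     (\<forall>\<Lambda> \<Lambda>'. finite \<Lambda>' \<and> \<Lambda> \<subseteq> \<Lambda>' \<longrightarrow>
        (\<forall>A\<in>sets Omega. \<forall>\<omega>.
           (\<integral>\<omega>'. measure (\<gamma> \<Lambda> \<omega>') A \<partial>(\<gamma> \<Lambda>' \<omega>)) = measure (\<gamma> \<Lambda>' \<omega>) A))"

text \<open>Nonnull (imposed for nonempty finite Lambda; for Lambda = {} the only cylinder is
  Omega itself, of probability 1).\<close>
definition nonnull :: "('s set \<Rightarrow> ('s \<Rightarrow> 'e) \<Rightarrow> ('s \<Rightarrow> 'e) measure) \<Rightarrow> bool" where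
  "nonnull \<gamma> \<longleftrightarrow>
     (\<forall>\<Lambda>. finite \<Lambda> \<and> \<Lambda> \<noteq> {} \<longrightarrow>
        (\<exists>a b. 0 < a \<and> a < b \<and> b < 1 \<and>
           a < (INF p\<in>configs \<Lambda> \<times> UNIV. measure (\<gamma> \<Lambda> (snd p)) (cyl \<Lambda> (fst p))) \<and>
           (SUP p\<in>configs \<Lambda> \<times> UNIV. measure (\<gamma> \<Lambda> (snd p)) (cyl \<Lambda> (fst p))) < b))"

definition spec_trans_inv :: "('s::plus set \<Rightarrow> ('s \<Rightarrow> 'e) \<Rightarrow> ('s \<Rightarrow> 'e) measure) \<Rightarrow> bool" where
  "spec_trans_inv \<gamma> \<longleftrightarrow>
     (\<forall>\<Lambda> x A \<omega>. finite \<Lambda> \<longrightarrow> A \<in> sets Omega \<longrightarrow>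
        measure (\<gamma> ((\<lambda>y. y + x) ` \<Lambda>) \<omega>) A = measure (\<gamma> \<Lambda> (shift x \<omega>)) (shift x ` A))"

definition inv_prob :: "('s::plus \<Rightarrow> 'e) measure \<Rightarrow> bool" where
  "inv_prob \<mu> \<longleftrightarrow> prob_space \<mu> \<and> sets \<mu> = sets Omega \<and>
     (\<forall>x. distr \<mu> Omega (shift x) = \<mu>)"

definition gibbs :: "('s set \<Rightarrow> ('s \<Rightarrow> 'e) \<Rightarrow> ('s \<Rightarrow> 'e) measure) \<Rightarrow> ('s \<Rightarrow> 'e) measure \<Rightarrow> bool" where
  "gibbs \<gamma> \<mu> \<longleftrightarrow> prob_space \<mu> \<and> sets \<mu> = sets Omega \<and>
     (\<forall>\<Lambda> A. finite \<Lambda> \<longrightarrow> A \<in> sets Omega \<longrightarrow>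
        (AE \<omega> in \<mu>. real_cond_exp \<mu> (Fsub (- \<Lambda>)) (indicator A) \<omega> = measure (\<gamma> \<Lambda> \<omega>) A))"

definition gibbs_inv :: "('s::plus set \<Rightarrow> ('s \<Rightarrow> 'e) \<Rightarrow> ('s \<Rightarrow> 'e) measure) \<Rightarrow> ('s \<Rightarrow> 'e) measure \<Rightarrow> bool" where
  "gibbs_inv \<gamma> \<mu> \<longleftrightarrow> gibbs \<gamma> \<mu> \<and> inv_prob \<mu>"

definition local_fun :: "(('s \<Rightarrow> 'e) \<Rightarrow> real) \<Rightarrow> bool" where
  "local_fun f \<longleftrightarrow> (\<exists>\<Delta>. finite \<Delta> \<and> f \<in> borel_measurable (Fsub \<Delta>))"

definition cont_points :: "('s set \<Rightarrow> ('s \<Rightarrow> 'e) \<Rightarrow> ('s \<Rightarrow> 'e) measure) \<Rightarrow> ('s \<Rightarrow> 'e) set" where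
  "cont_points \<gamma> = {\<omega>. \<forall>\<Lambda> f. finite \<Lambda> \<and> local_fun f \<longrightarrow>
     (\<forall>\<epsilon>>0. \<exists>U. openin Omega_top U \<and> \<omega> \<in> U \<and>
        (\<forall>\<omega>'\<in>U. \<bar>(\<integral>\<sigma>. f \<sigma> \<partial>(\<gamma> \<Lambda> \<omega>')) - (\<integral>\<sigma>. f \<sigma> \<partial>(\<gamma> \<Lambda> \<omega>))\<bar> < \<epsilon>))}"

definition almost_gibbs :: "('s set \<Rightarrow> ('s \<Rightarrow> 'e) \<Rightarrow> ('s \<Rightarrow> 'e) measure) \<Rightarrow> ('s \<Rightarrow> 'e) measure \<Rightarrow> bool" where
  "almost_gibbs \<gamma> \<mu> \<longleftrightarrow> gibbs \<gamma> \<mu> \<and> measure \<mu> (cont_points \<gamma>) = 1"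

definition cube :: "nat \<Rightarrow> (int ^ 'd) set" where
  "cube n = {x. \<forall>i. - int n \<le> x $ i \<and> x $ i \<le> int n}"

text \<open>h_Lambda(mu|nu), with 0 log 0 = 0 and value +infinity if mu_Lambda is not
  absolutely continuous w.r.t. nu_Lambda.\<close>
definition rel_ent_fin :: "('s \<Rightarrow> 'e) measure \<Rightarrow> ('s \<Rightarrow> 'e) measure \<Rightarrow> 's set \<Rightarrow> ereal" where
  "rel_ent_fin \<mu> \<nu> \<Lambda> =
     (if \<exists>\<sigma>\<in>configs \<Lambda>. measure \<nu> (cyl \<Lambda> \<sigma>) = 0 \<and> measure \<mu> (cyl \<Lambda> \<sigma>) \<noteq> 0 then \<infinity>
      else ereal (\<Sum>\<sigma>\<in>configs \<Lambda>. measure \<mu> (cyl \<Lambda> \<sigma>) *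
                     ln (measure \<mu> (cyl \<Lambda> \<sigma>) / measure \<nu> (cyl \<Lambda> \<sigma>))))"

definition rel_ent_rate_is :: "((int ^ 'd) \<Rightarrow> 'e) measure \<Rightarrow> ((int ^ 'd) \<Rightarrow> 'e) measure \<Rightarrow> ereal \<Rightarrow> bool" where
  "rel_ent_rate_is \<mu> \<nu> c \<longleftrightarrow>
     ((\<lambda>n. rel_ent_fin \<mu> \<nu> (cube n) / ereal (real (card (cube n :: (int ^ 'd) set)))) \<longlonglongrightarrow> c)"

end

theory Submission
  imports Defs
begin

text \<open>
  Fix a finite \<open>\<Lambda>\<close>. For finite \<open>\<Delta> \<supseteq> \<Lambda>\<close> the increment \<open>h\<^sub>\<Delta>(\<mu>|\<nu>) - h\<^bsub>\<Delta> - \<Lambda>\<^esub>(\<mu>|\<nu>)\<close> is the relative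
  entropy of \<open>\<mu>\<close> on \<open>\<Delta>\<close> with respect to the law obtained by drawing the spins in \<open>\<Delta> - \<Lambda>\<close> from
  \<open>\<mu>\<close> and those in \<open>\<Lambda>\<close> from the conditional law of \<open>\<nu>\<close>; hence it controls the total variation
  distance of the two. Packing \<open>cube N\<close> with disjoint translates of a fixed cube, a vanishing
  entropy density forces arbitrarily small increments for regions \<open>\<Delta>\<close> that contain any prescribed
  finite set. Along such regions exhausting the lattice, the conditional probability of a local event
  under \<open>\<nu>\<close> given the spins in \<open>\<Delta> - \<Lambda>\<close> is an average of the kernel over configurations agreeing
  with \<open>\<omega>\<close> on \<open>\<Delta> - \<Lambda>\<close>, so it tends to the kernel at every continuity point \<open>\<omega>\<close>. Dominated
  convergence under \<open>\<mu>\<close> yields \<open>\<mu> = \<mu>\<gamma>\<^sub>\<Lambda>\<close>, and properness turns this into the conditional statement.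
\<close>

section \<open>Functions of finitely many spins\<close>

text \<open>The value type is arbitrary so that real functions, membership predicates and the
  set-valued map \<open>cyl \<Delta>\<close> are covered alike.\<close>

definition depends_on :: "'s set \<Rightarrow> (('s \<Rightarrow> 'e) \<Rightarrow> 'b) \<Rightarrow> bool" where
  "depends_on \<Delta> f \<longleftrightarrow> (\<forall>\<omega> \<omega>'. (\<forall>x\<in>\<Delta>. \<omega> x = \<omega>' x) \<longrightarrow> f \<omega> = f \<omega>')"

lemma depends_onD: "depends_on \<Delta> f \<Longrightarrow> (\<And>x. x \<in> \<Delta> \<Longrightarrow> \<omega> x = \<omega>' x) \<Longrightarrow> f \<omega> = f \<omega>'"
  unfolding depends_on_def by blast

lemma depends_on_mono: "depends_on \<Delta> f \<Longrightarrow> \<Delta> \<subseteq> \<Delta>' \<Longrightarrow> depends_on \<Delta>' f"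
  unfolding depends_on_def by blast

lemma depends_on_cyl: "depends_on \<Delta> (cyl \<Delta>)"
  unfolding depends_on_def cyl_def by auto

lemma depends_on_comp: "depends_on \<Delta> f \<Longrightarrow> depends_on \<Delta> (\<lambda>\<omega>. g (f \<omega>))"
  unfolding depends_on_def by (intro allI impI arg_cong[where f = g]) simp

lemma depends_on_comp2:
  "depends_on \<Delta> f \<Longrightarrow> depends_on \<Delta> g \<Longrightarrow> depends_on \<Delta> (\<lambda>\<omega>. h (f \<omega>) (g \<omega>))"
  unfolding depends_on_def by (intro allI impI arg_cong2[where f = h]) simp_all

lemma depends_on_indicator:
  "depends_on \<Delta> (\<lambda>\<omega>. \<omega> \<in> A) \<Longrightarrow> depends_on \<Delta> (indicator A :: _ \<Rightarrow> real)"
  unfolding indicator_def of_bool_def by (rule depends_on_comp)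

section \<open>Sigma-fields generated by coordinates\<close>

lemma space_Omega [simp]: "space Omega = UNIV"
  by (simp add: Omega_def space_PiM)

lemma space_Fsub [simp]: "space (Fsub \<Gamma>) = UNIV"
  by (simp add: Fsub_def space_measure_of_conv)

lemma sets_Fsub: "sets (Fsub \<Gamma>) = sigma_sets UNIV {{\<omega>. \<omega> x = a} | x a. x \<in> \<Gamma>}"
  by (simp add: Fsub_def)

lemma coordinate_event_in_Omega: "{\<omega>. \<omega> x = a} \<in> sets Omega"
proof -
  have "(\<lambda>\<omega>. \<omega> x) \<in> measurable Omega (count_space UNIV)"
    unfolding Omega_def by (rule measurable_component_singleton) simp
  from measurable_sets[OF this, of "{a}"] show ?thesis
    by (simp add: vimage_def)
qed

lemma sets_Fsub_subset: "sets (Fsub \<Gamma>) \<subseteq> sets Omega"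
proof -
  have "sigma_sets (space Omega) {{\<omega>. \<omega> x = a} | x a. x \<in> \<Gamma>} \<subseteq> sets Omega"
    by (rule sets.sigma_sets_subset) (auto simp: coordinate_event_in_Omega)
  then show ?thesis by (simp add: sets_Fsub)
qed

lemma Fsub_measurable_imp_Omega: "f \<in> borel_measurable (Fsub \<Gamma>) \<Longrightarrow> f \<in> borel_measurable Omega"
  using sets_Fsub_subset[of \<Gamma>] by (auto simp: measurable_def)

lemma cyl_in_Fsub:
  assumes "finite \<Delta>" "\<Delta> \<subseteq> \<Gamma>"
  shows "cyl \<Delta> \<sigma> \<in> sets (Fsub \<Gamma>)"
proof -
  have "{\<omega> \<in> space (Fsub \<Gamma>). \<forall>x\<in>\<Delta>. \<omega> x = \<sigma> x} \<in> sets (Fsub \<Gamma>)"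
  proof (rule sets.sets_Collect_finite_All[OF _ assms(1)])
    fix x assume "x \<in> \<Delta>"
    then have "x \<in> \<Gamma>" using assms(2) by auto
    then have "{\<omega>. \<omega> x = \<sigma> x} \<in> sigma_sets UNIV {{\<omega>. \<omega> x = a} | x a. x \<in> \<Gamma>}"
      by (intro sigma_sets.Basic) blast
    then show "{\<omega> \<in> space (Fsub \<Gamma>). \<omega> x = \<sigma> x} \<in> sets (Fsub \<Gamma>)"
      by (simp add: sets_Fsub)
  qed
  then show ?thesis by (simp add: cyl_def)
qed

lemma cyl_in_Omega: "finite \<Delta> \<Longrightarrow> cyl \<Delta> \<sigma> \<in> sets Omega"
  using cyl_in_Fsub[of \<Delta> UNIV] sets_Fsub_subset by blast

lemma cyl_antimono: "\<Delta>' \<subseteq> \<Delta> \<Longrightarrow> cyl \<Delta> \<sigma> \<subseteq> cyl \<Delta>' \<sigma>"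
  by (auto simp: cyl_def)

text \<open>The property holds for the generators and survives complements and countable unions, so
  the region may be infinite, such as the complement of a finite set.\<close>

lemma Fsub_set_depends_on:
  assumes "B \<in> sets (Fsub \<Gamma>)"
  shows "depends_on \<Gamma> (\<lambda>\<omega>. \<omega> \<in> B)"
  using assms unfolding sets_Fsub
proof (induction rule: sigma_sets.induct)
  case (Union B)
  then show ?case unfolding depends_on_def by (simp only: UN_iff) blast
qed (auto simp: depends_on_def)

text \<open>Singletons are Borel, so each level set of \<open>f\<close> is an event of
  \<open>Fsub \<Gamma>\<close> and cannot separate configurations that agree on \<Gamma>.\<close>

lemma Fsub_measurable_depends_on:
  fixes f :: "('s \<Rightarrow> 'e) \<Rightarrow> real"
  assumes "f \<in> borel_measurable (Fsub \<Gamma>)"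
  shows "depends_on \<Gamma> f"
  unfolding depends_on_def
proof (intro allI impI)
  fix \<omega> \<omega>' :: "'s \<Rightarrow> 'e" assume eq: "\<forall>x\<in>\<Gamma>. \<omega> x = \<omega>' x"
  have "f -` {f \<omega>} \<inter> space (Fsub \<Gamma>) \<in> sets (Fsub \<Gamma>)"
    by (rule measurable_sets[OF assms]) simp
  from depends_onD[OF Fsub_set_depends_on[OF this], of \<omega> \<omega>'] eq
  show "f \<omega> = f \<omega>'" by simp
qed

section \<open>Integrals of local functions as finite sums\<close>

lemma finite_configs: "finite \<Delta> \<Longrightarrow> finite (configs \<Delta> :: ('s \<Rightarrow> 'e::finite) set)"
  unfolding configs_def by (rule finite_PiE) auto

text \<open>The cylinders over \<open>configs \<Delta>\<close> partition the configuration space, so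
  only the term of \<open>restrict \<omega> \<Delta>\<close> survives.\<close>

lemma sum_configs_indicator_cyl:
  fixes f :: "('s \<Rightarrow> 'e::finite) \<Rightarrow> real"
  assumes "finite \<Delta>" "depends_on \<Delta> f"
  shows "(\<Sum>\<sigma>\<in>configs \<Delta>. f \<sigma> * indicator (cyl \<Delta> \<sigma>) \<omega>) = f \<omega>"
proof -
  have r: "restrict \<omega> \<Delta> \<in> configs \<Delta>" by (auto simp: configs_def)
  have "f \<sigma> * indicator (cyl \<Delta> \<sigma>) \<omega> = (if \<sigma> = restrict \<omega> \<Delta> then f \<omega> else 0)"
    if "\<sigma> \<in> configs \<Delta>" for \<sigma>
  proof (cases "\<omega> \<in> cyl \<Delta> \<sigma>")
    case True
    then have eq: "\<And>x. x \<in> \<Delta> \<Longrightarrow> \<sigma> x = \<omega> x" by (auto simp: cyl_def)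
    \<comment> \<open>Members of \<open>configs \<Delta>\<close> are extensional: both functions are
      \<open>undefined\<close> off \<Delta>, so agreement on \<Delta> is equality.\<close>
    then have "\<sigma> = restrict \<omega> \<Delta>"
      using that by (auto simp: configs_def fun_eq_iff restrict_def PiE_iff extensional_def)
    then show ?thesis using True depends_onD[OF assms(2), of \<sigma> \<omega>] eq by simp
  next
    case False
    then have "\<sigma> \<noteq> restrict \<omega> \<Delta>" by (auto simp: cyl_def)
    then show ?thesis using False by simp
  qed
  then have "(\<Sum>\<sigma>\<in>configs \<Delta>. f \<sigma> * indicator (cyl \<Delta> \<sigma>) \<omega>)
      = (\<Sum>\<sigma>\<in>configs \<Delta>. if \<sigma> = restrict \<omega> \<Delta> then f \<omega> else 0)"
    by (rule sum.cong[OF refl])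
  also have "\<dots> = f \<omega>"
    using sum.delta[OF finite_configs[OF assms(1)], of "restrict \<omega> \<Delta>" "\<lambda>_. f \<omega>"] r by simp
  finally show ?thesis .
qed

lemma depends_on_Fsub_measurable:
  fixes f :: "('s \<Rightarrow> 'e::finite) \<Rightarrow> real"
  assumes "finite \<Delta>" "depends_on \<Delta> f"
  shows "f \<in> borel_measurable (Fsub \<Delta>)"
proof -
  have "(\<lambda>\<omega>. \<Sum>\<sigma>\<in>configs \<Delta>. f \<sigma> * indicator (cyl \<Delta> \<sigma>) \<omega>) \<in> borel_measurable (Fsub \<Delta>)"
    using cyl_in_Fsub[OF assms(1) order_refl]
    by (intro borel_measurable_sum borel_measurable_times borel_measurable_const
        borel_measurable_indicator) auto
  then show ?thesis by (simp add: sum_configs_indicator_cyl[OF assms])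
qed

text \<open>This supplies integrability and value at once. A function may be expanded over any
  finite region containing its own, which is how marginals are compared later.\<close>

lemma has_bochner_integral_depends_on:
  fixes f :: "('s \<Rightarrow> 'e::finite) \<Rightarrow> real"
  assumes "prob_space M" "sets M = sets Omega" "finite \<Delta>" "depends_on \<Delta> f"
  shows "has_bochner_integral M f (\<Sum>\<sigma>\<in>configs \<Delta>. measure M (cyl \<Delta> \<sigma>) * f \<sigma>)"
proof -
  interpret prob_space M by fact
  have "has_bochner_integral M (\<lambda>\<omega>. \<Sum>\<sigma>\<in>configs \<Delta>. f \<sigma> * indicator (cyl \<Delta> \<sigma>) \<omega>)
      (\<Sum>\<sigma>\<in>configs \<Delta>. f \<sigma> * measure M (cyl \<Delta> \<sigma>))"
  proof (intro has_bochner_integral_sum has_bochner_integral_mult_right)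
    fix \<sigma> :: "'s \<Rightarrow> 'e"
    show "has_bochner_integral M (indicator (cyl \<Delta> \<sigma>)) (measure M (cyl \<Delta> \<sigma>))"
      by (rule has_bochner_integral_real_indicator)
        (use cyl_in_Omega[OF assms(3), of \<sigma>] assms(2) in \<open>auto simp: less_top[symmetric]\<close>)
  qed
  then show ?thesis by (simp add: sum_configs_indicator_cyl[OF assms(3,4)] mult.commute)
qed

lemmas integral_depends_on = has_bochner_integral_integral_eq[OF has_bochner_integral_depends_on]
lemmas integrable_depends_on = integrable.intros[OF has_bochner_integral_depends_on]

section \<open>Relative entropy in finite regions\<close>

text \<open>Relative entropy dominates the squared Hellinger distance, because \<open>- ln t \<ge> 1 - t\<close> at
  \<open>t = sqrt (q x / p x)\<close>; Cauchy--Schwarz then bounds the \<open>L\<^sup>1\<close> distance.\<close>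

lemma l1_sq_le_relative_entropy:
  fixes p q :: "'a \<Rightarrow> real"
  assumes p0: "\<And>x. x \<in> S \<Longrightarrow> p x \<ge> 0" and q0: "\<And>x. x \<in> S \<Longrightarrow> q x \<ge> 0"
    and ac: "\<And>x. x \<in> S \<Longrightarrow> p x > 0 \<Longrightarrow> q x > 0"
    and p1: "sum p S = 1" and q1: "sum q S = 1"
  shows "(\<Sum>x\<in>S. \<bar>p x - q x\<bar>)\<^sup>2 \<le> 4 * (\<Sum>x\<in>S. p x * ln (p x / q x))"
proof -
  define a b where "a x = sqrt (p x)" and "b x = sqrt (q x)" for x
  have sq: "(a x)\<^sup>2 = p x" "(b x)\<^sup>2 = q x" "a x \<ge> 0" "b x \<ge> 0" if "x \<in> S" for x
    using p0[OF that] q0[OF that] by (auto simp: a_def b_def)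
  have pt: "2 * p x - 2 * (a x * b x) \<le> p x * ln (p x / q x)" if x: "x \<in> S" for x
  proof (cases "p x > 0")
    case True
    then have pos: "a x > 0" "b x > 0" using ac[OF x] by (auto simp: a_def b_def)
    have "ln (b x / a x) \<le> b x / a x - 1" using pos by (intro ln_le_minus_one) auto
    then have *: "p x * (2 * (1 - b x / a x)) \<le> p x * (- 2 * ln (b x / a x))"
      using True by (intro mult_left_mono) auto
    have "ln (p x / q x) = ln ((a x)\<^sup>2) - ln ((b x)\<^sup>2)"
      using sq[OF x] True ac[OF x] by (simp add: ln_div)
    then have ln_eq: "- 2 * ln (b x / a x) = ln (p x / q x)"
      using pos by (simp add: ln_div ln_realpow)
    have "p x * (2 * (1 - b x / a x)) = 2 * p x - 2 * (a x * b x)"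
      using pos by (simp add: sq(1)[OF x, symmetric] power2_eq_square field_simps)
    with * show ?thesis unfolding ln_eq by simp
  next
    case False
    then have "p x = 0" using p0[OF x] by simp
    then show ?thesis by (simp add: a_def)
  qed
  have "(\<Sum>x\<in>S. (a x - b x)\<^sup>2) = (\<Sum>x\<in>S. p x + q x - 2 * (a x * b x))"
    by (intro sum.cong refl) (simp add: power2_diff sq)
  \<comment> \<open>Both total masses are 1, so \<open>q x\<close> may be replaced by
    \<open>p x\<close> under the sum; this produces the left side of \<open>pt\<close>.\<close>
  also have "\<dots> = (\<Sum>x\<in>S. 2 * p x - 2 * (a x * b x))"
    using p1 q1 by (simp add: sum_subtractf sum.distrib sum_distrib_left[symmetric])
  also have "\<dots> \<le> (\<Sum>x\<in>S. p x * ln (p x / q x))" by (intro sum_mono pt)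
  finally have minus: "(\<Sum>x\<in>S. (a x - b x)\<^sup>2) \<le> (\<Sum>x\<in>S. p x * ln (p x / q x))" .
  have "(\<Sum>x\<in>S. (a x + b x)\<^sup>2) \<le> (\<Sum>x\<in>S. 2 * p x + 2 * q x)"
  proof (rule sum_mono)
    fix x assume x: "x \<in> S"
    have "0 \<le> (a x - b x)\<^sup>2" by simp
    then show "(a x + b x)\<^sup>2 \<le> 2 * p x + 2 * q x"
      using sq[OF x] by (simp add: power2_sum power2_diff)
  qed
  also have "\<dots> = 4" using p1 q1 by (simp add: sum.distrib sum_distrib_left[symmetric])
  finally have plus: "(\<Sum>x\<in>S. (a x + b x)\<^sup>2) \<le> 4" .
  \<comment> \<open>Difference of squares; after Cauchy--Schwarz the factor with
    \<open>a x + b x\<close> is at most 4, whence the constant.\<close>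
  have "(\<Sum>x\<in>S. \<bar>p x - q x\<bar>) = (\<Sum>x\<in>S. \<bar>a x - b x\<bar> * (a x + b x))"
  proof (rule sum.cong[OF refl])
    fix x assume x: "x \<in> S"
    have "p x - q x = (a x - b x) * (a x + b x)"
      using sq[OF x] by (simp add: power2_eq_square algebra_simps)
    then show "\<bar>p x - q x\<bar> = \<bar>a x - b x\<bar> * (a x + b x)"
      using sq(3,4)[OF x] by (simp add: abs_mult)
  qed
  then have "(\<Sum>x\<in>S. \<bar>p x - q x\<bar>)\<^sup>2 \<le> (\<Sum>x\<in>S. \<bar>a x - b x\<bar>\<^sup>2) * (\<Sum>x\<in>S. (a x + b x)\<^sup>2)"
    using Cauchy_Schwarz_ineq_sum[of "\<lambda>x. \<bar>a x - b x\<bar>" "\<lambda>x. a x + b x" S] by simp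
  also have "\<dots> \<le> (\<Sum>x\<in>S. p x * ln (p x / q x)) * 4"
  proof (rule mult_mono)
    have "0 \<le> (\<Sum>x\<in>S. (a x - b x)\<^sup>2)" by (simp add: sum_nonneg)
    then show "0 \<le> (\<Sum>x\<in>S. p x * ln (p x / q x))" using minus by linarith
  qed (use minus plus in \<open>simp_all add: sum_nonneg\<close>)
  finally show ?thesis by simp
qed

text \<open>Positivity on finite cylinders makes conditional probabilities of \<nu> genuine
  quotients and finite-volume entropies finite. It will come from nonnullness through
  \<open>gibbs_cyl_pos\<close>.\<close>

locale positive_reference =
  fixes \<mu> \<nu> :: "('s \<Rightarrow> 'e::finite) measure"
  assumes prob_\<mu>: "prob_space \<mu>" and sets_\<mu>: "sets \<mu> = sets Omega"
    and prob_\<nu>: "prob_space \<nu>" and sets_\<nu>: "sets \<nu> = sets Omega"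
    and cyl_pos: "finite \<Delta> \<Longrightarrow> 0 < measure \<nu> (cyl \<Delta> \<sigma>)"
begin

text \<open>Logarithmic density of the \<Delta>-marginals; whatever \<open>ln\<close> yields on
  cylinders of \<mu>-measure zero has no weight under \<mu>.\<close>

definition log_ratio :: "'s set \<Rightarrow> ('s \<Rightarrow> 'e) \<Rightarrow> real" where
  "log_ratio \<Delta> \<omega> = ln (measure \<mu> (cyl \<Delta> \<omega>) / measure \<nu> (cyl \<Delta> \<omega>))"

text \<open>Written as an expectation, entropies of different regions are integrals over one space,
  so they can be subtracted under the integral and translated by a change of variables.\<close>

definition ent :: "'s set \<Rightarrow> real" where
  "ent \<Delta> = (\<integral>\<omega>. log_ratio \<Delta> \<omega> \<partial>\<mu>)"

lemma depends_on_log_ratio: "depends_on \<Delta> (log_ratio \<Delta>)"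
  unfolding log_ratio_def by (intro depends_on_comp[OF depends_on_cyl])

lemma rel_ent_fin_eq_ent:
  assumes "finite \<Delta>"
  shows "rel_ent_fin \<mu> \<nu> \<Delta> = ereal (ent \<Delta>)"
proof -
  have "\<not> (\<exists>\<sigma>\<in>configs \<Delta>. measure \<nu> (cyl \<Delta> \<sigma>) = 0 \<and> measure \<mu> (cyl \<Delta> \<sigma>) \<noteq> 0)"
    using cyl_pos[OF assms] by (auto simp: less_le)
  then show ?thesis
    using integral_depends_on[OF prob_\<mu> sets_\<mu> assms depends_on_log_ratio]
    by (simp add: rel_ent_fin_def ent_def) (simp add: log_ratio_def)
qed

text \<open>The second distribution has the \<open>\<Delta>'\<close>-marginal of \<open>\<mu>\<close> and the conditional law of \<open>\<nu>\<close>
  on \<open>\<Delta> - \<Delta>'\<close>, so the relative entropy of \<open>\<mu>\<close> with respect to it is exactly the entropy increment.\<close>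

lemma l1_sq_le_ent_diff:
  assumes fin: "finite \<Delta>" and sub: "\<Delta>' \<subseteq> \<Delta>"
  shows "(\<Sum>\<sigma>\<in>configs \<Delta>. \<bar>measure \<mu> (cyl \<Delta> \<sigma>) -
      measure \<nu> (cyl \<Delta> \<sigma>) * (measure \<mu> (cyl \<Delta>' \<sigma>) / measure \<nu> (cyl \<Delta>' \<sigma>))\<bar>)\<^sup>2
    \<le> 4 * (ent \<Delta> - ent \<Delta>')"
proof -
  interpret M: prob_space \<mu> by (rule prob_\<mu>)
  interpret N: prob_space \<nu> by (rule prob_\<nu>)
  \<comment> \<open>\<open>G\<close> is the density of \<mu> with respect to \<nu> on the events of
    \<Delta>', and \<open>q\<close> is the \<Delta>-marginal of the measure with \<nu>-density
    \<open>G\<close>.\<close>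
  define G where "G \<omega> = measure \<mu> (cyl \<Delta>' \<omega>) / measure \<nu> (cyl \<Delta>' \<omega>)" for \<omega>
  define q where "q \<sigma> = measure \<nu> (cyl \<Delta> \<sigma>) * G \<sigma>" for \<sigma>
  have fin': "finite \<Delta>'" using fin sub finite_subset by blast
  have G': "depends_on \<Delta>' G"
    unfolding G_def by (intro depends_on_comp[OF depends_on_cyl])
  have one: "depends_on D (\<lambda>_. 1::real)" for D :: "'s set" by (simp add: depends_on_def)
  have sum_p: "(\<Sum>\<sigma>\<in>configs D. measure \<mu> (cyl D \<sigma>)) = 1" if "finite D" for D
    using integral_depends_on[OF prob_\<mu> sets_\<mu> that one] by (simp add: M.prob_space)
  \<comment> \<open>The \<nu>-integral of \<open>G\<close> is expanded over \<Delta> and over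
    \<Delta>'; in the second expansion the denominators cancel and leave the total mass of
    \<mu>.\<close>
  have "sum q (configs \<Delta>) = (\<integral>\<omega>. G \<omega> \<partial>\<nu>)"
    using integral_depends_on[OF prob_\<nu> sets_\<nu> fin depends_on_mono[OF G' sub]]
    by (simp add: q_def)
  also have "\<dots> = (\<Sum>\<sigma>\<in>configs \<Delta>'. measure \<nu> (cyl \<Delta>' \<sigma>) * G \<sigma>)"
    by (rule integral_depends_on[OF prob_\<nu> sets_\<nu> fin' G'])
  also have "\<dots> = (\<Sum>\<sigma>\<in>configs \<Delta>'. measure \<mu> (cyl \<Delta>' \<sigma>))"
    using cyl_pos[OF fin'] by (intro sum.cong refl) (simp add: G_def less_le)
  finally have sum_q: "sum q (configs \<Delta>) = 1" using sum_p[OF fin'] by simp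
  \<comment> \<open>The cylinder over \<Delta> lies in the one over \<Delta>', so positive mass is
    inherited. This gives absolute continuity and permits splitting the logarithm.\<close>
  have G_pos: "G \<sigma> > 0" if "measure \<mu> (cyl \<Delta> \<sigma>) > 0" for \<sigma>
  proof -
    have "measure \<mu> (cyl \<Delta> \<sigma>) \<le> measure \<mu> (cyl \<Delta>' \<sigma>)"
      by (rule M.finite_measure_mono[OF cyl_antimono[OF sub]])
        (simp add: sets_\<mu> cyl_in_Omega fin')
    with that show ?thesis using cyl_pos[OF fin', of \<sigma>] by (simp add: G_def)
  qed
  have "(\<Sum>\<sigma>\<in>configs \<Delta>. measure \<mu> (cyl \<Delta> \<sigma>) * ln (measure \<mu> (cyl \<Delta> \<sigma>) / q \<sigma>))
      = (\<Sum>\<sigma>\<in>configs \<Delta>. measure \<mu> (cyl \<Delta> \<sigma>) * (log_ratio \<Delta> \<sigma> - log_ratio \<Delta>' \<sigma>))"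
  proof (rule sum.cong[OF refl])
    fix \<sigma> :: "'s \<Rightarrow> 'e"
    show "measure \<mu> (cyl \<Delta> \<sigma>) * ln (measure \<mu> (cyl \<Delta> \<sigma>) / q \<sigma>)
        = measure \<mu> (cyl \<Delta> \<sigma>) * (log_ratio \<Delta> \<sigma> - log_ratio \<Delta>' \<sigma>)"
    proof (cases "measure \<mu> (cyl \<Delta> \<sigma>) > 0")
      case True
      have "log_ratio \<Delta>' \<sigma> = ln (G \<sigma>)" by (simp add: log_ratio_def G_def)
      moreover have "ln (measure \<mu> (cyl \<Delta> \<sigma>) / q \<sigma>) = log_ratio \<Delta> \<sigma> - ln (G \<sigma>)"
        using True G_pos[OF True] cyl_pos[OF fin, of \<sigma>]
        by (simp add: log_ratio_def q_def ln_div ln_mult)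
      ultimately show ?thesis by simp
    next
      case False
      then have "measure \<mu> (cyl \<Delta> \<sigma>) = 0" by (simp add: zero_less_measure_iff)
      then show ?thesis by simp
    qed
  qed
  also have "\<dots> = (\<integral>\<omega>. log_ratio \<Delta> \<omega> - log_ratio \<Delta>' \<omega> \<partial>\<mu>)"
    by (rule integral_depends_on[OF prob_\<mu> sets_\<mu> fin, symmetric])
      (intro depends_on_comp2[where h = minus] depends_on_log_ratio
        depends_on_mono[OF depends_on_log_ratio sub])
  also have "\<dots> = ent \<Delta> - ent \<Delta>'"
    unfolding ent_def
    by (rule Bochner_Integration.integral_diff)
      (rule integrable_depends_on[OF prob_\<mu> sets_\<mu> _ depends_on_log_ratio], fact)+
  finally have kl: "(\<Sum>\<sigma>\<in>configs \<Delta>. measure \<mu> (cyl \<Delta> \<sigma>) * ln (measure \<mu> (cyl \<Delta> \<sigma>) / q \<sigma>))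
      = ent \<Delta> - ent \<Delta>'" .
  have "(\<Sum>\<sigma>\<in>configs \<Delta>. \<bar>measure \<mu> (cyl \<Delta> \<sigma>) - q \<sigma>\<bar>)\<^sup>2 \<le> 4 * (ent \<Delta> - ent \<Delta>')"
    unfolding kl[symmetric]
  proof (rule l1_sq_le_relative_entropy)
    show "q \<sigma> \<ge> 0" for \<sigma> by (simp add: q_def G_def)
    show "q \<sigma> > 0" if "measure \<mu> (cyl \<Delta> \<sigma>) > 0" for \<sigma>
      using G_pos[OF that] cyl_pos[OF fin, of \<sigma>] by (simp add: q_def)
  qed (simp_all add: finite_configs fin sum_p sum_q)
  then show ?thesis by (simp add: q_def G_def)
qed

lemma ent_mono: "finite \<Delta> \<Longrightarrow> \<Delta>' \<subseteq> \<Delta> \<Longrightarrow> ent \<Delta>' \<le> ent \<Delta>"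
  using order_trans[OF zero_le_power2 l1_sq_le_ent_diff] by fastforce

lemma ent_empty: "ent {} = 0"
proof -
  interpret M: prob_space \<mu> by (rule prob_\<mu>)
  interpret N: prob_space \<nu> by (rule prob_\<nu>)
  have "space \<mu> = UNIV" "space \<nu> = UNIV"
    using sets_eq_imp_space_eq[OF sets_\<mu>] sets_eq_imp_space_eq[OF sets_\<nu>] by auto
  then show ?thesis
    using M.prob_space N.prob_space by (simp add: ent_def log_ratio_def cyl_def)
qed

text \<open>The integral is the probability of \<open>A\<close> when the spins in \<Delta>' follow
  \<mu> and the rest the conditional law of \<nu>. For an event of \<Delta> the error is at most the
  distance bounded in \<open>l1_sq_le_ent_diff\<close>.\<close>

lemma conditional_approx_sq_le_ent_diff:
  assumes fin: "finite \<Delta>" and sub: "\<Delta>' \<subseteq> \<Delta>" and A: "depends_on \<Delta> (\<lambda>\<omega>. \<omega> \<in> A)"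
    and A_sets: "A \<in> sets Omega"
  shows "(measure \<mu> A - (\<integral>\<omega>. measure \<nu> (A \<inter> cyl \<Delta>' \<omega>) / measure \<nu> (cyl \<Delta>' \<omega>) \<partial>\<mu>))\<^sup>2
    \<le> 4 * (ent \<Delta> - ent \<Delta>')"
proof -
  interpret M: prob_space \<mu> by (rule prob_\<mu>)
  interpret N: prob_space \<nu> by (rule prob_\<nu>)
  define G where "G \<omega> = measure \<mu> (cyl \<Delta>' \<omega>) / measure \<nu> (cyl \<Delta>' \<omega>)" for \<omega>
  define q where "q \<sigma> = measure \<nu> (cyl \<Delta> \<sigma>) * G \<sigma>" for \<sigma>
  have fin': "finite \<Delta>'" using fin sub finite_subset by blast
  have G': "depends_on \<Delta>' G"
    unfolding G_def by (intro depends_on_comp[OF depends_on_cyl])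
  have "measure \<mu> A = (\<integral>\<omega>. indicator A \<omega> \<partial>\<mu>)"
    using A_sets sets_\<mu> by (simp add: sets_eq_imp_space_eq[OF sets_\<mu>])
  also have "\<dots> = (\<Sum>\<sigma>\<in>configs \<Delta>. measure \<mu> (cyl \<Delta> \<sigma>) * indicator A \<sigma>)"
    by (rule integral_depends_on[OF prob_\<mu> sets_\<mu> fin depends_on_indicator[OF A]])
  finally have mA: "measure \<mu> A = (\<Sum>\<sigma>\<in>configs \<Delta>. measure \<mu> (cyl \<Delta> \<sigma>) * indicator A \<sigma>)" .
  have "(\<integral>\<omega>. measure \<nu> (A \<inter> cyl \<Delta>' \<omega>) / measure \<nu> (cyl \<Delta>' \<omega>) \<partial>\<mu>)
      = (\<Sum>\<sigma>\<in>configs \<Delta>'. measure \<mu> (cyl \<Delta>' \<sigma>) * (measure \<nu> (A \<inter> cyl \<Delta>' \<sigma>) / measure \<nu> (cyl \<Delta>' \<sigma>)))"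
    by (rule integral_depends_on[OF prob_\<mu> sets_\<mu> fin'])
      (rule depends_on_comp[OF depends_on_cyl])
  also have "\<dots> = (\<Sum>\<sigma>\<in>configs \<Delta>'. G \<sigma> * measure \<nu> (A \<inter> cyl \<Delta>' \<sigma>))"
    by (simp add: G_def)
  also have "\<dots> = (\<integral>\<omega>. (\<Sum>\<sigma>\<in>configs \<Delta>'. G \<sigma> * indicator (A \<inter> cyl \<Delta>' \<sigma>) \<omega>) \<partial>\<nu>)"
  proof -
    have *: "A \<inter> cyl \<Delta>' \<sigma> \<in> sets \<nu>" for \<sigma>
      using A_sets cyl_in_Omega[OF fin', of \<sigma>] by (simp add: sets_\<nu>)
    then show ?thesis
      by (subst Bochner_Integration.integral_sum)
        (auto simp: less_top[symmetric] sets_eq_imp_space_eq[OF sets_\<nu>])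
  qed
  \<comment> \<open>The cylinders over \<Delta>' partition the space, so the sum collapses to
    \<open>G\<close>; the product depends only on spins in \<Delta> and can be expanded
    there.\<close>
  also have "\<dots> = (\<integral>\<omega>. G \<omega> * indicator A \<omega> \<partial>\<nu>)"
  proof (rule Bochner_Integration.integral_cong[OF refl])
    fix \<omega> :: "'s \<Rightarrow> 'e"
    have "(\<Sum>\<sigma>\<in>configs \<Delta>'. G \<sigma> * indicator (A \<inter> cyl \<Delta>' \<sigma>) \<omega>)
        = (\<Sum>\<sigma>\<in>configs \<Delta>'. G \<sigma> * indicator (cyl \<Delta>' \<sigma>) \<omega>) * indicator A \<omega>"
      by (simp add: sum_distrib_left indicator_inter_arith mult_ac)
    then show "(\<Sum>\<sigma>\<in>configs \<Delta>'. G \<sigma> * indicator (A \<inter> cyl \<Delta>' \<sigma>) \<omega>) = G \<omega> * indicator A \<omega>"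
      by (simp add: sum_configs_indicator_cyl[OF fin' G'])
  qed
  also have "\<dots> = (\<Sum>\<sigma>\<in>configs \<Delta>. q \<sigma> * indicator A \<sigma>)"
    unfolding q_def mult.assoc
    by (rule integral_depends_on[OF prob_\<nu> sets_\<nu> fin])
      (intro depends_on_comp2[where h = times] depends_on_mono[OF G' sub] depends_on_indicator[OF A])
  finally have "\<bar>measure \<mu> A - (\<integral>\<omega>. measure \<nu> (A \<inter> cyl \<Delta>' \<omega>) / measure \<nu> (cyl \<Delta>' \<omega>) \<partial>\<mu>)\<bar>
      = \<bar>\<Sum>\<sigma>\<in>configs \<Delta>. (measure \<mu> (cyl \<Delta> \<sigma>) - q \<sigma>) * indicator A \<sigma>\<bar>"
    unfolding mA by (simp add: sum_subtractf left_diff_distrib)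
  also have "\<dots> \<le> (\<Sum>\<sigma>\<in>configs \<Delta>. \<bar>(measure \<mu> (cyl \<Delta> \<sigma>) - q \<sigma>) * indicator A \<sigma>\<bar>)"
    by (rule sum_abs)
  also have "\<dots> \<le> (\<Sum>\<sigma>\<in>configs \<Delta>. \<bar>measure \<mu> (cyl \<Delta> \<sigma>) - q \<sigma>\<bar>)"
    by (intro sum_mono) (auto simp: indicator_def)
  finally have "\<bar>measure \<mu> A - (\<integral>\<omega>. measure \<nu> (A \<inter> cyl \<Delta>' \<omega>) / measure \<nu> (cyl \<Delta>' \<omega>) \<partial>\<mu>)\<bar>\<^sup>2
      \<le> (\<Sum>\<sigma>\<in>configs \<Delta>. \<bar>measure \<mu> (cyl \<Delta> \<sigma>) - q \<sigma>\<bar>)\<^sup>2"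
    by (intro power_mono) auto
  also have "\<dots> \<le> 4 * (ent \<Delta> - ent \<Delta>')"
    unfolding q_def G_def by (rule l1_sq_le_ent_diff[OF fin sub])
  finally show ?thesis by simp
qed

end

section \<open>Packing and entropy increments\<close>

lemma measurable_shift: "shift x \<in> measurable Omega Omega"
  unfolding Omega_def
proof (rule measurable_PiM_single')
  show "(\<lambda>\<omega>. shift x \<omega> i) \<in> measurable (PiM UNIV (\<lambda>_. count_space UNIV)) (count_space UNIV)" for i
    unfolding shift_def by (rule measurable_component_singleton) simp
qed simp

text \<open>\<open>shift x\<close> reads the spin at \<open>x + y\<close>, so the preimage under it
  of a cylinder over \<Delta> is a cylinder over the region moved by \<open>x\<close>.\<close>

lemma measure_cyl_translate:
  assumes "inv_prob M" "finite \<Delta>"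
  shows "measure M (cyl ((+) x ` \<Delta>) \<omega>) = measure M (cyl \<Delta> (shift x \<omega>))"
proof -
  have s: "sets M = sets Omega" and d: "distr M Omega (shift x) = M"
    using assms(1) by (auto simp: inv_prob_def)
  have "measure M (cyl \<Delta> (shift x \<omega>)) = measure (distr M Omega (shift x)) (cyl \<Delta> (shift x \<omega>))"
    by (simp add: d)
  also have "\<dots> = measure M (shift x -` cyl \<Delta> (shift x \<omega>) \<inter> space M)"
    by (rule measure_distr)
      (simp_all add: measurable_cong_sets[OF s refl] measurable_shift cyl_in_Omega assms(2))
  also have "shift x -` cyl \<Delta> (shift x \<omega>) \<inter> space M = cyl ((+) x ` \<Delta>) \<omega>"
    by (auto simp: sets_eq_imp_space_eq[OF s] cyl_def shift_def)
  finally show ?thesis by simp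
qed

section \<open>Cubes of the lattice\<close>

lemma finite_cube: "finite (cube n :: (int ^ 'd) set)"
  and card_cube: "card (cube n :: (int ^ 'd) set) = (2 * n + 1) ^ CARD('d)"
proof -
  have eq: "(cube n :: (int ^ 'd) set) = vec_lambda ` (PiE UNIV (\<lambda>_. {- int n..int n}))"
  proof (intro set_eqI iffI)
    fix x :: "int ^ 'd" assume "x \<in> cube n"
    then have "vec_nth x \<in> PiE UNIV (\<lambda>_. {- int n..int n})" by (auto simp: cube_def)
    then show "x \<in> vec_lambda ` (PiE UNIV (\<lambda>_. {- int n..int n}))"
      by (metis image_eqI vec_nth_inverse)
  qed (auto simp: cube_def PiE_iff)
  have inj: "inj_on vec_lambda (S :: ('d \<Rightarrow> int) set)" for S
    by (auto intro!: inj_onI simp: vec_lambda_inject)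
  show "finite (cube n :: (int ^ 'd) set)"
    unfolding eq by (intro finite_imageI finite_PiE) auto
  show "card (cube n :: (int ^ 'd) set) = (2 * n + 1) ^ CARD('d)"
    unfolding eq by (simp add: card_image[OF inj] card_PiE nat_add_distrib nat_mult_distrib)
qed

lemma in_cube_iff: "x \<in> cube n \<longleftrightarrow> (\<forall>i. \<bar>x $ i\<bar> \<le> int n)"
  by (auto simp: cube_def abs_le_iff minus_le_iff)

lemma cube_mono: "m \<le> n \<Longrightarrow> cube m \<subseteq> cube n"
  unfolding in_cube_iff subset_iff by (intro allI impI, rule order_trans[of _ "int m"]) auto

lemma finite_subset_cube:
  assumes "finite (S :: (int ^ 'd) set)"
  shows "\<exists>m. S \<subseteq> cube m"
  using assms
proof induction
  case (insert x S)
  then obtain m where m: "S \<subseteq> cube m" by auto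
  define k where "k = (\<Sum>i\<in>UNIV. nat \<bar>x $ i\<bar>)"
  have "nat \<bar>x $ i\<bar> \<le> k" for i unfolding k_def by (rule member_le_sum) auto
  then have "\<bar>x $ i\<bar> \<le> int k" for i by (simp add: nat_le_iff)
  then have "x \<in> cube k" by (auto simp: in_cube_iff)
  then have "insert x S \<subseteq> cube (max m k)"
    using m cube_mono[of m "max m k"] cube_mono[of k "max m k"] by auto
  then show ?case by blast
qed simp

section \<open>Entropy of disjoint translates\<close>

locale invariant_reference = positive_reference \<mu> \<nu>
  for \<mu> \<nu> :: "('s::ab_group_add \<Rightarrow> 'e::finite) measure" +
  assumes inv_\<mu>: "inv_prob \<mu>" and inv_\<nu>: "inv_prob \<nu>"
begin

lemma ent_translate:
  assumes "finite \<Delta>"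
  shows "ent ((+) x ` \<Delta>) = ent \<Delta>"
proof -
  have d: "distr \<mu> Omega (shift x) = \<mu>" using inv_\<mu> by (auto simp: inv_prob_def)
  have m: "log_ratio \<Delta> \<in> borel_measurable Omega"
    by (rule Fsub_measurable_imp_Omega[OF depends_on_Fsub_measurable[OF assms depends_on_log_ratio]])
  have "log_ratio ((+) x ` \<Delta>) \<omega> = log_ratio \<Delta> (shift x \<omega>)" for \<omega>
    using assms by (simp add: log_ratio_def measure_cyl_translate inv_\<mu> inv_\<nu>)
  then have "ent ((+) x ` \<Delta>) = (\<integral>\<omega>. log_ratio \<Delta> (shift x \<omega>) \<partial>\<mu>)"
    by (simp add: ent_def)
  also have "\<dots> = (\<integral>\<omega>. log_ratio \<Delta> \<omega> \<partial>distr \<mu> Omega (shift x))"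
    by (rule integral_distr[symmetric, OF _ m])
      (simp add: measurable_cong_sets[OF sets_\<mu> refl] measurable_shift)
  finally show ?thesis by (simp add: d ent_def)
qed

text \<open>Add the blocks one at a time: in its own frame, the newest block sees a region
  containing \<open>W\<close>, so it contributes at least \<open>\<delta>\<close>.\<close>

lemma ent_packing:
  assumes W: "finite W" "L \<subseteq> W"
    and inc: "\<And>\<Delta>. finite \<Delta> \<Longrightarrow> W \<subseteq> \<Delta> \<Longrightarrow> \<delta> \<le> ent \<Delta> - ent (\<Delta> - L)"
    and "finite Y" "disjoint_family_on (\<lambda>y. (+) y ` W) Y"
  shows "real (card Y) * \<delta> \<le> ent (\<Union>y\<in>Y. (+) y ` W)"
  using assms(4,5)
proof (induction Y)
  case empty
  then show ?case by (simp add: ent_empty)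
next
  case (insert y Y)
  define U where "U = (\<Union>y\<in>Y. (+) y ` W)"
  define D where "D = (+) y ` W \<union> U"
  \<comment> \<open>\<open>D'\<close> is \<open>D\<close> moved back so that the newest block
    becomes \<open>W\<close> itself and \<open>inc\<close> applies.\<close>
  define D' where "D' = (+) (- y) ` D"
  have fin: "finite U" "finite D" "finite D'"
    using insert.hyps W by (auto simp: U_def D_def D'_def)
  have D_eq: "(+) y ` D' = D" by (simp add: D'_def image_image)
  have sub: "W \<subseteq> D'"
    by (auto simp: D'_def D_def image_image image_Un)
  have inj: "inj ((+) y)" by simp
  have "(+) y ` (D' - L) = D - (+) y ` L"
    by (simp add: image_set_diff[OF inj] D_eq)
  then have "ent (D' - L) = ent (D - (+) y ` L)"
    using ent_translate[of "D' - L" y] fin by simp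
  moreover have "ent D' = ent D"
    using ent_translate[of "D'" y] fin D_eq by simp
  ultimately have "\<delta> \<le> ent D - ent (D - (+) y ` L)"
    using inc[OF fin(3) sub] by simp
  \<comment> \<open>The translate of \<open>L\<close> lies in the new block, which is disjoint from
    \<open>U\<close>; removing it leaves \<open>U\<close> intact.\<close>
  moreover have "ent U \<le> ent (D - (+) y ` L)"
  proof (rule ent_mono)
    have "(+) y ` W \<inter> (+) z ` W = {}" if "z \<in> Y" for z
      using insert.hyps that by (intro disjoint_family_onD[OF insert.prems]) auto
    then have "(+) y ` W \<inter> U = {}" by (simp add: U_def Int_UN_distrib)
    then show "U \<subseteq> D - (+) y ` L" using W(2) by (auto simp: D_def)
  qed (simp add: fin)
  moreover have "real (card Y) * \<delta> \<le> ent U"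
    unfolding U_def using insert.prems by (intro insert.IH) (simp add: disjoint_family_on_def)
  ultimately have "real (card (insert y Y)) * \<delta> \<le> ent D"
    using insert.hyps by (simp add: algebra_simps)
  then show ?case by (simp add: D_def U_def)
qed

end

section \<open>Consequences of vanishing entropy density\<close>

text \<open>Adding \<open>m\<close> turns the offset into a remainder modulo
  \<open>2 * m + 1\<close>, so integer division recovers the block index.\<close>

lemma int_block_unique:
  fixes a b y z m :: int
  assumes "\<bar>a\<bar> \<le> m" "\<bar>b\<bar> \<le> m" "(2 * m + 1) * y + a = (2 * m + 1) * z + b"
  shows "y = z"
proof -
  have "y = ((2 * m + 1) * y + (a + m)) div (2 * m + 1)" using assms(1) by simp
  also have "\<dots> = ((2 * m + 1) * z + (b + m)) div (2 * m + 1)" using assms(3) by (simp only: add.assoc[symmetric])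
  also have "\<dots> = z" using assms(2) by simp
  finally show ?thesis .
qed

text \<open>Otherwise every region containing \<open>W\<close> has increment at least \<epsilon>,
  and packing cubes with translates of one block keeps the entropy per site above a positive
  constant along a sequence of cubes.\<close>

lemma small_entropy_increment:
  fixes \<mu> \<nu> :: "(int ^ 'd \<Rightarrow> 'e::finite) measure"
  assumes "invariant_reference \<mu> \<nu>" and rate: "rel_ent_rate_is \<mu> \<nu> 0"
    and "finite L" "finite W" "\<epsilon> > 0"
  shows "\<exists>\<Delta>. finite \<Delta> \<and> W \<subseteq> \<Delta> \<and>
    positive_reference.ent \<mu> \<nu> \<Delta> - positive_reference.ent \<mu> \<nu> (\<Delta> - L) < \<epsilon>"
proof (rule ccontr)
  interpret invariant_reference \<mu> \<nu> by fact
  assume neg: "\<not> ?thesis"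
  obtain m where m: "W \<union> L \<subseteq> cube m"
    using finite_subset_cube[of "W \<union> L"] assms by auto
  \<comment> \<open>\<open>cube m\<close> serves as the block: it contains \<open>W\<close>, so the
    negated claim applies, and \<open>L\<close>, as the packing bound demands.\<close>
  have inc: "\<epsilon> \<le> ent \<Delta> - ent (\<Delta> - L)" if "finite \<Delta>" "cube m \<subseteq> \<Delta>" for \<Delta>
    using neg m that by (meson Un_subset_iff not_less order_trans)
  \<comment> \<open>\<open>t y\<close> is the centre of block \<open>y\<close> and \<open>C\<close>
    the number of sites in a block. As \<open>2 * r K + 1 = (2 * m + 1) * (2 * K + 1)\<close>, the
    blocks indexed by \<open>cube K\<close> fill \<open>cube (r K)\<close> exactly.\<close>
  define r where "r K = (2 * m + 1) * K + m" for K
  define t :: "int ^ 'd \<Rightarrow> int ^ 'd" where "t y = (\<chi> i. (2 * int m + 1) * y $ i)" for y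
  define C where "C = real (2 * m + 1) ^ CARD('d)"
  have C: "C > 0" by (simp add: C_def)
  have bound: "\<epsilon> / C \<le> ent (cube (r K)) / real (card (cube (r K) :: (int ^ 'd) set))" for K
  proof -
    \<comment> \<open>A site determines its block: zero offsets give injectivity of
      \<open>t\<close>, general ones disjointness of the blocks.\<close>
    have t_eq: "y = z" if "t y + a = t z + b" "a \<in> cube m" "b \<in> cube m" for y z a b
    proof -
      have "y $ i = z $ i" for i
      proof (rule int_block_unique[of "a $ i" "int m" "b $ i"])
        show "\<bar>a $ i\<bar> \<le> int m" "\<bar>b $ i\<bar> \<le> int m"
          using that(2,3) by (auto simp: in_cube_iff)
        show "(2 * int m + 1) * y $ i + a $ i = (2 * int m + 1) * z $ i + b $ i"
          using arg_cong[OF that(1), of "\<lambda>v. v $ i"] by (simp add: t_def)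
      qed
      then show ?thesis by (simp add: vec_eq_iff)
    qed
    have zero: "(0 :: int ^ 'd) \<in> cube m" by (simp add: cube_def)
    have inj: "inj_on t (cube K)"
      using t_eq[OF _ zero zero] by (intro inj_onI) simp
    have disj: "disjoint_family_on (\<lambda>y. (+) y ` cube m) (t ` cube K)"
      unfolding disjoint_family_on_def using t_eq by blast
    have sub: "(\<Union>y\<in>t ` cube K. (+) y ` cube m) \<subseteq> cube (r K)"
    proof clarify
      fix y a :: "int ^ 'd" assume y: "y \<in> cube K" and a: "a \<in> cube m"
      have "\<bar>(t y + a) $ i\<bar> \<le> int (r K)" for i
      proof -
        have "\<bar>y $ i\<bar> \<le> int K" "\<bar>a $ i\<bar> \<le> int m"
          using y a by (auto simp: in_cube_iff)
        then have "(2 * int m + 1) * \<bar>y $ i\<bar> + \<bar>a $ i\<bar> \<le> (2 * int m + 1) * int K + int m"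
          by (intro add_mono mult_left_mono) auto
        moreover have "\<bar>(t y + a) $ i\<bar> \<le> (2 * int m + 1) * \<bar>y $ i\<bar> + \<bar>a $ i\<bar>"
          using abs_triangle_ineq[of "(2 * int m + 1) * y $ i" "a $ i"]
          by (simp add: t_def abs_mult)
        ultimately show ?thesis by (simp add: r_def algebra_simps)
      qed
      then show "t y + a \<in> cube (r K)" by (auto simp: in_cube_iff)
    qed
    have "real (card (cube K :: (int ^ 'd) set)) * \<epsilon> = real (card (t ` cube K)) * \<epsilon>"
      by (simp add: card_image[OF inj])
    also have "\<dots> \<le> ent (\<Union>y\<in>t ` cube K. (+) y ` cube m)"
      using m by (intro ent_packing[of _ L] inc disj) (auto simp: finite_cube)
    also have "\<dots> \<le> ent (cube (r K))" by (rule ent_mono[OF finite_cube sub])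
    finally have le: "real (card (cube K :: (int ^ 'd) set)) * \<epsilon> \<le> ent (cube (r K))" .
    have "2 * r K + 1 = (2 * m + 1) * (2 * K + 1)" by (simp add: r_def algebra_simps)
    then have card: "real (card (cube (r K) :: (int ^ 'd) set)) = C * real (card (cube K :: (int ^ 'd) set))"
      by (simp only: card_cube C_def power_mult_distrib of_nat_power of_nat_mult)
    have pos: "real (card (cube K :: (int ^ 'd) set)) > 0" by (simp add: card_cube)
    show ?thesis using le pos C unfolding card by (simp add: field_simps)
  qed
  have "(\<lambda>n. ereal (ent (cube n) / real (card (cube n :: (int ^ 'd) set)))) \<longlonglongrightarrow> ereal 0"
    using rate by (simp add: rel_ent_rate_is_def rel_ent_fin_eq_ent finite_cube card_cube zero_ereal_def)
  then have "(\<lambda>n. ent (cube n) / real (card (cube n :: (int ^ 'd) set))) \<longlonglongrightarrow> 0"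
    by simp
  moreover have "strict_mono r" unfolding r_def by (intro strict_monoI add_strict_right_mono mult_strict_left_mono) auto
  ultimately have "(\<lambda>K. ent (cube (r K)) / real (card (cube (r K) :: (int ^ 'd) set))) \<longlonglongrightarrow> 0"
    using LIMSEQ_subseq_LIMSEQ[of _ 0 r] by (auto simp: o_def)
  then have "\<epsilon> / C \<le> 0" by (rule LIMSEQ_le_const) (use bound in blast)
  then show False using \<open>\<epsilon> > 0\<close> C by (simp add: field_simps)
qed

section \<open>Specifications and Gibbs measures\<close>

text \<open>A basic open set of the product topology constrains only finitely many
  coordinates.\<close>

lemma openin_Omega_top_contains_cyl:
  assumes "openin Omega_top U" "\<omega> \<in> U"
  shows "\<exists>S. finite S \<and> cyl S \<omega> \<subseteq> U"
proof -
  from product_topology_open_contains_basis[OF assms[unfolded Omega_top_def]]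
  obtain X where X: "\<omega> \<in> (\<Pi>\<^sub>E i\<in>UNIV. X i)" "finite {i. X i \<noteq> UNIV}" "(\<Pi>\<^sub>E i\<in>UNIV. X i) \<subseteq> U"
    by auto
  have "cyl {i. X i \<noteq> UNIV} \<omega> \<subseteq> (\<Pi>\<^sub>E i\<in>UNIV. X i)"
  proof
    fix \<omega>' assume "\<omega>' \<in> cyl {i. X i \<noteq> UNIV} \<omega>"
    then have "\<omega>' i \<in> X i" for i
      using X(1) by (cases "X i = UNIV") (auto simp: cyl_def PiE_iff)
    then show "\<omega>' \<in> (\<Pi>\<^sub>E i\<in>UNIV. X i)" by (simp add: PiE_iff)
  qed
  with X show ?thesis by blast
qed

lemma
  assumes "is_spec \<gamma>" "finite \<Lambda>"
  shows is_spec_prob_space: "prob_space (\<gamma> \<Lambda> \<omega>)"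
    and is_spec_sets: "sets (\<gamma> \<Lambda> \<omega>) = sets Omega"
    and is_spec_measurable:
      "A \<in> sets Omega \<Longrightarrow> (\<lambda>\<omega>. measure (\<gamma> \<Lambda> \<omega>) A) \<in> borel_measurable (Fsub (- \<Lambda>))"
    and is_spec_proper:
      "B \<in> sets (Fsub (- \<Lambda>)) \<Longrightarrow> measure (\<gamma> \<Lambda> \<omega>) B = indicator B \<omega>"
  using assms unfolding is_spec_def by blast+

lemma is_spec_integrable:
  assumes "is_spec \<gamma>" "finite \<Lambda>" "A \<in> sets Omega" "prob_space M" "sets M = sets Omega"
  shows "integrable M (\<lambda>\<omega>. measure (\<gamma> \<Lambda> \<omega>) A)"
proof -
  interpret prob_space M by fact
  have "(\<lambda>\<omega>. measure (\<gamma> \<Lambda> \<omega>) A) \<in> borel_measurable M"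
    using Fsub_measurable_imp_Omega[OF is_spec_measurable[OF assms(1-3)]]
    by (simp add: measurable_cong_sets[OF assms(5) refl])
  then show ?thesis
    using prob_space.prob_le_1[OF is_spec_prob_space[OF assms(1,2)]]
    by (intro integrable_const_bound[where B = 1]) auto
qed

lemma finite_measure_subalgebra_Fsub:
  assumes "prob_space M" "sets M = sets Omega"
  shows "finite_measure_subalgebra M (Fsub \<Gamma>)"
proof -
  interpret prob_space M by fact
  show ?thesis
    by standard (use sets_Fsub_subset assms(2) in
      \<open>auto simp: subalgebra_def sets_eq_imp_space_eq[OF assms(2)]\<close>)
qed

text \<open>This is the defining integral identity of conditional expectation on an exterior event
  \<open>B\<close>, with the kernel substituted almost everywhere.\<close>

lemma gibbs_measure_Int:
  assumes "is_spec \<gamma>" "gibbs \<gamma> \<nu>" "finite \<Lambda>" "A \<in> sets Omega" "B \<in> sets (Fsub (- \<Lambda>))"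
  shows "measure \<nu> (A \<inter> B) = (\<integral>\<omega>. indicator B \<omega> * measure (\<gamma> \<Lambda> \<omega>) A \<partial>\<nu>)"
proof -
  have prob: "prob_space \<nu>" and sets: "sets \<nu> = sets Omega"
    and ae: "AE \<omega> in \<nu>. real_cond_exp \<nu> (Fsub (- \<Lambda>)) (indicator A) \<omega> = measure (\<gamma> \<Lambda> \<omega>) A"
    using assms unfolding gibbs_def by auto
  interpret finite_measure_subalgebra \<nu> "Fsub (- \<Lambda>)"
    by (rule finite_measure_subalgebra_Fsub[OF prob sets])
  have B: "B \<in> sets \<nu>" using assms(5) sets_Fsub_subset sets by blast
  have A: "A \<in> sets \<nu>" using assms(4) sets by simp
  have m: "(\<lambda>\<omega>. measure (\<gamma> \<Lambda> \<omega>) A) \<in> borel_measurable \<nu>"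
    using is_spec_integrable[OF assms(1,3,4) prob sets] by simp
  have "measure \<nu> (A \<inter> B) = (\<integral>\<omega>\<in>B. indicator A \<omega> \<partial>\<nu>)"
    using A B sets.sets_into_space[of "A \<inter> B" \<nu>]
    by (simp add: set_lebesgue_integral_def indicator_inter_arith[symmetric] Int_absorb2 Int_commute)
  also have "\<dots> = (\<integral>\<omega>\<in>B. real_cond_exp \<nu> (Fsub (- \<Lambda>)) (indicator A) \<omega> \<partial>\<nu>)"
    using A by (intro real_cond_exp_intA assms(5)) (simp add: less_top[symmetric])
  also have "\<dots> = (\<integral>\<omega>\<in>B. measure (\<gamma> \<Lambda> \<omega>) A \<partial>\<nu>)"
    unfolding set_lebesgue_integral_def
    by (rule integral_cong_AE) (use ae B m in \<open>auto elim!: eventually_mono\<close>)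
  finally show ?thesis by (simp add: set_lebesgue_integral_def)
qed

text \<open>Nonnullness bounds the kernel on the cylinder from below uniformly in the boundary
  condition; the bound survives integration under \<nu>.\<close>

lemma gibbs_cyl_pos:
  fixes \<nu> :: "('s \<Rightarrow> 'e::finite) measure"
  assumes "is_spec \<gamma>" "nonnull \<gamma>" "gibbs \<gamma> \<nu>" "finite \<Delta>"
  shows "0 < measure \<nu> (cyl \<Delta> \<sigma>)"
proof -
  have prob: "prob_space \<nu>" and sets: "sets \<nu> = sets Omega"
    using assms unfolding gibbs_def by auto
  interpret prob_space \<nu> by (rule prob)
  show ?thesis
  proof (cases "\<Delta> = {}")
    \<comment> \<open>\<open>nonnull\<close> speaks of nonempty regions; over the empty one the
      cylinder is the whole space.\<close>
    case True
    then show ?thesis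
      using prob_space by (simp add: cyl_def sets_eq_imp_space_eq[OF sets])
  next
    case False
    let ?P = "\<lambda>p. measure (\<gamma> \<Delta> (snd p)) (cyl \<Delta> (fst p))"
    obtain a where a: "0 < a" "a < (INF p\<in>configs \<Delta> \<times> UNIV. ?P p)"
      using assms(2,4) False unfolding nonnull_def by blast
    have bdd: "bdd_below (?P ` (configs \<Delta> \<times> UNIV))"
      by (rule bdd_belowI[of _ 0]) auto
    have r: "cyl \<Delta> (restrict \<sigma> \<Delta>) = cyl \<Delta> \<sigma>" by (auto simp: cyl_def)
    have lower: "a \<le> measure (\<gamma> \<Delta> \<omega>) (cyl \<Delta> \<sigma>)" for \<omega>
    proof -
      have "(INF p\<in>configs \<Delta> \<times> UNIV. ?P p) \<le> ?P (restrict \<sigma> \<Delta>, \<omega>)"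
        by (rule cINF_lower[OF bdd]) (auto simp: configs_def)
      with a r show ?thesis by simp
    qed
    have "a = (\<integral>\<omega>. a \<partial>\<nu>)" by (simp add: prob_space)
    also have "\<dots> \<le> (\<integral>\<omega>. measure (\<gamma> \<Delta> \<omega>) (cyl \<Delta> \<sigma>) \<partial>\<nu>)"
      using lower is_spec_integrable[OF assms(1,4) cyl_in_Omega[OF assms(4)] prob sets]
      by (intro integral_mono) auto
    also have "\<dots> = measure \<nu> (cyl \<Delta> \<sigma>)"
      using gibbs_measure_Int[OF assms(1,3,4) cyl_in_Omega[OF assms(4)] sets.top, of \<sigma>] by simp
    finally show ?thesis using a by simp
  qed
qed

text \<open>Finite-dimensional rectangles determine a finite measure, so \<mu> is invariant under
  the kernel on all events. For \<open>A \<inter> B\<close> with \<open>B\<close> exterior,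
  properness takes \<open>B\<close> out of the kernel, which characterises the conditional
  expectation.\<close>

lemma gibbsI_local:
  fixes \<mu> :: "('s \<Rightarrow> 'e::finite) measure"
  assumes "is_spec \<gamma>" "prob_space \<mu>" "sets \<mu> = sets Omega"
    and loc: "\<And>\<Lambda> J A. finite \<Lambda> \<Longrightarrow> finite J \<Longrightarrow> A \<in> sets Omega \<Longrightarrow> depends_on J (\<lambda>\<omega>. \<omega> \<in> A) \<Longrightarrow>
      measure \<mu> A = (\<integral>\<omega>. measure (\<gamma> \<Lambda> \<omega>) A \<partial>\<mu>)"
  shows "gibbs \<gamma> \<mu>"
  unfolding gibbs_def
proof (intro conjI allI impI assms(2,3))
  fix \<Lambda> :: "'s set" and A :: "('s \<Rightarrow> 'e) set"
  assume \<Lambda>: "finite \<Lambda>" and A: "A \<in> sets Omega"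
  interpret prob_space \<mu> by fact
  note int = is_spec_integrable[OF assms(1) \<Lambda> _ assms(2,3)]
  have space: "space \<mu> = UNIV" using sets_eq_imp_space_eq[OF assms(3)] by simp
  have em: "emeasure (\<gamma> \<Lambda> \<omega>) X = ennreal (measure (\<gamma> \<Lambda> \<omega>) X)" for \<omega> X
  proof -
    interpret K: prob_space "\<gamma> \<Lambda> \<omega>" by (rule is_spec_prob_space[OF assms(1) \<Lambda>])
    show ?thesis by (rule K.emeasure_eq_measure)
  qed
  have kernel: "\<gamma> \<Lambda> \<in> measurable \<mu> (subprob_algebra Omega)"
  proof (rule measurable_subprob_algebra)
    show "(\<lambda>\<omega>. emeasure (\<gamma> \<Lambda> \<omega>) X) \<in> borel_measurable \<mu>" if "X \<in> sets Omega" for X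
      unfolding em using int[OF that] by measurable
  qed (use is_spec_prob_space[OF assms(1) \<Lambda>] is_spec_sets[OF assms(1) \<Lambda>] in
      \<open>auto intro: prob_space_imp_subprob_space\<close>)
  have bind: "emeasure (\<mu> \<bind> \<gamma> \<Lambda>) X = ennreal (\<integral>\<omega>. measure (\<gamma> \<Lambda> \<omega>) X \<partial>\<mu>)" if "X \<in> sets Omega" for X
    using emeasure_bind[OF _ kernel that] nn_integral_eq_integral[OF int[OF that]]
    by (simp add: space em)
  have "\<mu> = \<mu> \<bind> \<gamma> \<Lambda>"
  proof (rule measure_eqI_PiM_infinite[where I = UNIV and M = "\<lambda>_. count_space UNIV"])
    show "sets \<mu> = sets (PiM UNIV (\<lambda>_. count_space UNIV))"
      using assms(3) by (simp add: Omega_def)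
    show "sets (\<mu> \<bind> \<gamma> \<Lambda>) = sets (PiM UNIV (\<lambda>_. count_space UNIV))"
      using sets_bind[of \<mu> "\<gamma> \<Lambda>" Omega] is_spec_sets[OF assms(1) \<Lambda>] by (simp add: Omega_def space)
    show "finite_measure \<mu>" by (rule finite_measure_axioms)
    fix F :: "'s \<Rightarrow> 'e set" and J :: "'s set" assume J: "finite J"
    let ?X = "prod_emb UNIV (\<lambda>_. count_space UNIV) J (Pi\<^sub>E J F)"
    have X: "?X \<in> sets Omega"
      unfolding Omega_def by (rule sets_PiM_I) (use J in auto)
    have "depends_on J (\<lambda>\<omega>. \<omega> \<in> ?X)"
      by (auto simp: depends_on_def prod_emb_def PiE_iff)
    from loc[OF \<Lambda> J X this] show "emeasure \<mu> ?X = emeasure (\<mu> \<bind> \<gamma> \<Lambda>) ?X"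
      by (simp add: bind[OF X] emeasure_eq_measure)
  qed
  then have inv: "measure \<mu> X = (\<integral>\<omega>. measure (\<gamma> \<Lambda> \<omega>) X \<partial>\<mu>)" if "X \<in> sets Omega" for X
    using bind[OF that] by (simp add: emeasure_eq_measure)
  interpret finite_measure_subalgebra \<mu> "Fsub (- \<Lambda>)"
    by (rule finite_measure_subalgebra_Fsub[OF assms(2,3)])
  show "AE \<omega> in \<mu>. real_cond_exp \<mu> (Fsub (- \<Lambda>)) (indicator A) \<omega> = measure (\<gamma> \<Lambda> \<omega>) A"
  proof (rule real_cond_exp_charact)
    fix B :: "('s \<Rightarrow> 'e) set" assume B: "B \<in> sets (Fsub (- \<Lambda>))"
    have B': "B \<in> sets Omega" using B sets_Fsub_subset by blast
    \<comment> \<open>By properness \<open>B\<close> has kernel mass 1 or 0 according to whether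
      \<open>\<omega> \<in> B\<close>; intersecting with it changes nothing or leaves a null
      set.\<close>
    have proper: "measure (\<gamma> \<Lambda> \<omega>) (A \<inter> B) = indicator B \<omega> * measure (\<gamma> \<Lambda> \<omega>) A" for \<omega>
    proof -
      interpret K: prob_space "\<gamma> \<Lambda> \<omega>" by (rule is_spec_prob_space[OF assms(1) \<Lambda>])
      have sets: "A \<in> K.events" "B \<in> K.events"
        using A B' is_spec_sets[OF assms(1) \<Lambda>] by auto
      have m: "measure (\<gamma> \<Lambda> \<omega>) B = indicator B \<omega>" by (rule is_spec_proper[OF assms(1) \<Lambda> B])
      show ?thesis
      proof (cases "\<omega> \<in> B")
        case True
        then have "AE x in \<gamma> \<Lambda> \<omega>. x \<in> B" using m sets by (simp add: K.prob_eq_1)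
        then have "measure (\<gamma> \<Lambda> \<omega>) (A \<inter> B) = measure (\<gamma> \<Lambda> \<omega>) A"
          using sets by (intro K.finite_measure_eq_AE) auto
        then show ?thesis using True by simp
      next
        case False
        then have "measure (\<gamma> \<Lambda> \<omega>) (A \<inter> B) \<le> 0"
          using K.finite_measure_mono[of "A \<inter> B" B] sets m by simp
        then show ?thesis using False by (simp add: measure_le_0_iff)
      qed
    qed
    have "(\<integral>\<omega>\<in>B. indicator A \<omega> \<partial>\<mu>) = measure \<mu> (A \<inter> B)"
      using A B'
      by (simp add: set_lebesgue_integral_def indicator_inter_arith[symmetric] space Int_commute)
    also have "\<dots> = (\<integral>\<omega>. measure (\<gamma> \<Lambda> \<omega>) (A \<inter> B) \<partial>\<mu>)" using A B' by (intro inv) auto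
    also have "\<dots> = (\<integral>\<omega>\<in>B. measure (\<gamma> \<Lambda> \<omega>) A \<partial>\<mu>)"
      by (simp add: proper set_lebesgue_integral_def)
    finally show "(\<integral>\<omega>\<in>B. indicator A \<omega> \<partial>\<mu>) = (\<integral>\<omega>\<in>B. measure (\<gamma> \<Lambda> \<omega>) A \<partial>\<mu>)" .
  qed (use int[OF A] is_spec_measurable[OF assms(1) \<Lambda> A] A assms(3) in \<open>auto simp: less_top[symmetric]\<close>)
qed

section \<open>Conditional probabilities at continuity points\<close>

text \<open>By \<open>gibbs_measure_Int\<close> the quotient is the \<nu>-average of the kernel over
  the cylinder, where for large \<open>n\<close> the kernel is nearly constant by continuity at
  \<omega>.\<close>

lemma conditional_tendsto_kernel:
  fixes \<nu> :: "('s \<Rightarrow> 'e::finite) measure"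
  assumes "is_spec \<gamma>" "gibbs \<gamma> \<nu>" "finite \<Lambda>" "A \<in> sets Omega"
    and J: "finite J" "depends_on J (\<lambda>\<omega>. \<omega> \<in> A)"
    and \<omega>: "\<omega> \<in> cont_points \<gamma>"
    and pos: "\<And>\<Delta> \<sigma>. finite \<Delta> \<Longrightarrow> 0 < measure \<nu> (cyl \<Delta> \<sigma>)"
    and fin: "\<And>n. finite (\<Delta> n)"
    and exhaust: "\<And>S. finite S \<Longrightarrow> eventually (\<lambda>n. S \<subseteq> \<Delta> n) sequentially"
  shows "(\<lambda>n. measure \<nu> (A \<inter> cyl (\<Delta> n - \<Lambda>) \<omega>) / measure \<nu> (cyl (\<Delta> n - \<Lambda>) \<omega>))
    \<longlonglongrightarrow> measure (\<gamma> \<Lambda> \<omega>) A"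
proof (rule LIMSEQ_I)
  fix r :: real assume "r > 0"
  \<comment> \<open>Averaging yields only a weak inequality; halving \<open>r\<close> restores a
    strict one.\<close>
  define \<epsilon> where "\<epsilon> = r / 2"
  have \<epsilon>: "\<epsilon> > 0" "\<epsilon> < r" using \<open>r > 0\<close> by (auto simp: \<epsilon>_def)
  have prob: "prob_space \<nu>" and sets: "sets \<nu> = sets Omega"
    using assms(2) unfolding gibbs_def by auto
  interpret prob_space \<nu> by (rule prob)
  let ?g = "\<lambda>\<omega>. measure (\<gamma> \<Lambda> \<omega>) A"
  have g: "(\<integral>\<sigma>. indicator A \<sigma> \<partial>(\<gamma> \<Lambda> \<omega>)) = ?g \<omega>" for \<omega>
    by (simp add: sets_eq_imp_space_eq[OF is_spec_sets[OF assms(1,3)]])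
  have loc: "local_fun (indicator A :: _ \<Rightarrow> real)"
    unfolding local_fun_def
    using depends_on_Fsub_measurable[OF J(1) depends_on_indicator[OF J(2)]] J(1) by blast
  from \<omega>[unfolded cont_points_def mem_Collect_eq, rule_format, OF conjI[OF assms(3) loc] \<epsilon>(1)]
  obtain U where U: "openin Omega_top U" "\<omega> \<in> U"
    and close: "\<And>\<omega>'. \<omega>' \<in> U \<Longrightarrow> \<bar>?g \<omega>' - ?g \<omega>\<bar> < \<epsilon>"
    unfolding g by blast
  obtain S where S: "finite S" "cyl S \<omega> \<subseteq> U" using openin_Omega_top_contains_cyl[OF U] by blast
  obtain N where N: "\<And>n. n \<ge> N \<Longrightarrow> S \<subseteq> \<Delta> n"
    using exhaust[OF S(1)] by (auto simp: eventually_sequentially)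
  have "norm (measure \<nu> (A \<inter> cyl (\<Delta> n - \<Lambda>) \<omega>) / measure \<nu> (cyl (\<Delta> n - \<Lambda>) \<omega>) - ?g \<omega>) < r" if "n \<ge> N" for n
  proof -
    define C where "C = cyl (\<Delta> n - \<Lambda>) \<omega>"
    have CF: "C \<in> sets (Fsub (- \<Lambda>))"
      unfolding C_def using fin by (intro cyl_in_Fsub) auto
    have C: "C \<in> sets \<nu>" using CF sets_Fsub_subset sets by blast
    have Cpos: "measure \<nu> C > 0" unfolding C_def using fin by (intro pos) auto
    have near: "\<bar>?g \<omega>' - ?g \<omega>\<bar> \<le> \<epsilon>" if "\<omega>' \<in> C" for \<omega>'
    proof -
      \<comment> \<open>The cylinder leaves the spins in \<Lambda> free, but the kernel ignores
        them. Overwriting them by those of \<omega> gives agreement with \<omega> on all of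
        \<open>S\<close>, even where \<open>S\<close> meets \<Lambda>.\<close>
      let ?w = "\<lambda>x. if x \<in> \<Lambda> then \<omega> x else \<omega>' x"
      have "?g \<omega>' = ?g ?w"
        by (rule depends_onD[OF Fsub_measurable_depends_on[OF is_spec_measurable[OF assms(1,3,4)]]]) auto
      moreover have "?w \<in> cyl S \<omega>"
        using \<open>\<omega>' \<in> C\<close> N[OF \<open>n \<ge> N\<close>] by (auto simp: C_def cyl_def)
      ultimately show ?thesis using close[of ?w] S(2) by auto
    qed
    have int: "integrable \<nu> (\<lambda>\<omega>'. indicator C \<omega>' * ?g \<omega>')" "integrable \<nu> (\<lambda>\<omega>'. indicator C \<omega>' * ?g \<omega>)"
      using integrable_real_mult_indicator[OF C is_spec_integrable[OF assms(1,3,4) prob sets]] C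
      by (auto simp: mult.commute less_top[symmetric])
    have "measure \<nu> (A \<inter> C) - ?g \<omega> * measure \<nu> C
        = (\<integral>\<omega>'. indicator C \<omega>' * ?g \<omega>' \<partial>\<nu>) - (\<integral>\<omega>'. indicator C \<omega>' * ?g \<omega> \<partial>\<nu>)"
      using gibbs_measure_Int[OF assms(1-4) CF] C
      by (simp add: sets_eq_imp_space_eq[OF sets] mult.commute)
    also have "\<dots> = (\<integral>\<omega>'. indicator C \<omega>' * ?g \<omega>' - indicator C \<omega>' * ?g \<omega> \<partial>\<nu>)"
      using int by simp
    finally have "\<bar>measure \<nu> (A \<inter> C) - ?g \<omega> * measure \<nu> C\<bar>
        \<le> (\<integral>\<omega>'. \<bar>indicator C \<omega>' * ?g \<omega>' - indicator C \<omega>' * ?g \<omega>\<bar> \<partial>\<nu>)"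
      by (simp add: integral_abs_bound)
    also have "\<dots> \<le> (\<integral>\<omega>'. \<epsilon> * indicator C \<omega>' \<partial>\<nu>)"
    proof (rule integral_mono)
      show "\<bar>indicator C \<omega>' * ?g \<omega>' - indicator C \<omega>' * ?g \<omega>\<bar> \<le> \<epsilon> * indicator C \<omega>'" for \<omega>'
        using near[of \<omega>'] by (cases "\<omega>' \<in> C") auto
    qed (use int C in \<open>auto simp: less_top[symmetric]\<close>)
    also have "\<dots> = \<epsilon> * measure \<nu> C" using C by (simp add: sets_eq_imp_space_eq[OF sets])
    finally have "\<bar>measure \<nu> (A \<inter> C) - ?g \<omega> * measure \<nu> C\<bar> \<le> \<epsilon> * measure \<nu> C" .
    moreover have "measure \<nu> (A \<inter> C) / measure \<nu> C - ?g \<omega> = (measure \<nu> (A \<inter> C) - ?g \<omega> * measure \<nu> C) / measure \<nu> C"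
      using Cpos by (simp add: field_simps)
    ultimately have "\<bar>measure \<nu> (A \<inter> C) / measure \<nu> C - ?g \<omega>\<bar> \<le> \<epsilon>"
      using Cpos by (simp add: abs_divide pos_divide_le_eq)
    then show ?thesis using \<epsilon>(2) by (simp add: C_def)
  qed
  then show "\<exists>N. \<forall>n\<ge>N. norm (measure \<nu> (A \<inter> cyl (\<Delta> n - \<Lambda>) \<omega>) / measure \<nu> (cyl (\<Delta> n - \<Lambda>) \<omega>) - ?g \<omega>) < r"
    by blast
qed

section \<open>The Gibbs property from zero entropy density\<close>

theorem theorem3p1:
  fixes \<gamma> :: "(int ^ 'd) set \<Rightarrow> ((int ^ 'd) \<Rightarrow> 'e::finite) \<Rightarrow> ((int ^ 'd) \<Rightarrow> 'e) measure"
    and \<nu> \<mu> :: "((int ^ 'd) \<Rightarrow> 'e) measure"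
  assumes "is_spec \<gamma>" and "nonnull \<gamma>" and "spec_trans_inv \<gamma>"
    and "gibbs_inv \<gamma> \<nu>"
    and "inv_prob \<mu>"
    and "rel_ent_rate_is \<mu> \<nu> 0"
    and "measure \<mu> (cont_points \<gamma>) = 1"
  shows "gibbs_inv \<gamma> \<mu> \<and> almost_gibbs \<gamma> \<mu>"
proof -
  have \<nu>: "gibbs \<gamma> \<nu>" "inv_prob \<nu>" using assms(4) by (auto simp: gibbs_inv_def)
  note pos = gibbs_cyl_pos[OF assms(1,2) \<nu>(1)]
  have inv_ref: "invariant_reference \<mu> \<nu>"
    using assms(5) \<nu>(2) pos
    by (intro invariant_reference.intro positive_reference.intro invariant_reference_axioms.intro)
      (simp_all add: inv_prob_def)
  then interpret invariant_reference \<mu> \<nu> .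
  interpret M: prob_space \<mu> by (rule prob_\<mu>)
  \<comment> \<open>A non-measurable set has \<open>measure\<close> 0, so the value 1 entails
    measurability.\<close>
  have "cont_points \<gamma> \<in> sets \<mu>"
    using assms(7) measure_notin_sets[of "cont_points \<gamma>" \<mu>] by force
  then have cont: "AE \<omega> in \<mu>. \<omega> \<in> cont_points \<gamma>"
    using assms(7) by (simp add: M.prob_eq_1)
  have "gibbs \<gamma> \<mu>"
  proof (rule gibbsI_local[OF assms(1) prob_\<mu> sets_\<mu>])
    fix \<Lambda> J :: "(int ^ 'd) set" and A :: "(int ^ 'd \<Rightarrow> 'e) set"
    assume \<Lambda>: "finite \<Lambda>" and J: "finite J" and A: "A \<in> sets Omega" "depends_on J (\<lambda>\<omega>. \<omega> \<in> A)"
    \<comment> \<open>\<open>J\<close> makes \<open>A\<close> an event of the region, the cubes make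
      the regions exhaust the lattice, and the bound drives the increments to zero.\<close>
    have "\<exists>\<Delta>. finite \<Delta> \<and> J \<union> cube n \<subseteq> \<Delta> \<and> ent \<Delta> - ent (\<Delta> - \<Lambda>) < 1 / real (Suc n)" for n
      by (rule small_entropy_increment[OF inv_ref assms(6) \<Lambda>]) (auto simp: J finite_cube)
    then obtain \<Delta> where fin: "\<And>n. finite (\<Delta> n)" and sub: "\<And>n. J \<union> cube n \<subseteq> \<Delta> n"
      and inc: "\<And>n. ent (\<Delta> n) - ent (\<Delta> n - \<Lambda>) < 1 / real (Suc n)"
      by metis
    define g where "g n \<omega> = measure \<nu> (A \<inter> cyl (\<Delta> n - \<Lambda>) \<omega>) / measure \<nu> (cyl (\<Delta> n - \<Lambda>) \<omega>)" for n \<omega>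
    have g_meas: "g n \<in> borel_measurable \<mu>" for n
    proof -
      have "depends_on (\<Delta> n - \<Lambda>) (g n)"
        unfolding g_def by (rule depends_on_comp[OF depends_on_cyl])
      then show ?thesis
        using has_bochner_integral_depends_on[OF prob_\<mu> sets_\<mu>, of "\<Delta> n - \<Lambda>" "g n"] fin
        by (auto intro: borel_measurable_has_bochner_integral)
    qed
    have exhaust: "eventually (\<lambda>n. S \<subseteq> \<Delta> n) sequentially" if S: "finite S" for S
    proof -
      obtain m where "S \<subseteq> cube m" using finite_subset_cube[OF S] by blast
      then have "S \<subseteq> \<Delta> n" if "n \<ge> m" for n using cube_mono[OF that] sub[of n] by blast
      then show ?thesis by (auto simp: eventually_sequentially)
    qed
    \<comment> \<open>Convergence holds at continuity points, hence \<mu>-almost everywhere, and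
      conditional probabilities are dominated by 1.\<close>
    have "(\<lambda>n. \<integral>\<omega>. g n \<omega> \<partial>\<mu>) \<longlonglongrightarrow> (\<integral>\<omega>. measure (\<gamma> \<Lambda> \<omega>) A \<partial>\<mu>)"
    proof (rule integral_dominated_convergence[where w = "\<lambda>_. 1"])
      show "AE \<omega> in \<mu>. (\<lambda>n. g n \<omega>) \<longlonglongrightarrow> measure (\<gamma> \<Lambda> \<omega>) A"
        using cont unfolding g_def
        by eventually_elim (rule conditional_tendsto_kernel[OF assms(1) \<nu>(1) \<Lambda> A(1) J A(2) _ pos fin exhaust])
      interpret N: prob_space \<nu> by (rule prob_\<nu>)
      have "norm (g n \<omega>) \<le> 1" for n \<omega>
      proof -
        have "measure \<nu> (A \<inter> cyl (\<Delta> n - \<Lambda>) \<omega>) \<le> measure \<nu> (cyl (\<Delta> n - \<Lambda>) \<omega>)"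
          by (rule N.finite_measure_mono) (use fin in \<open>auto simp: sets_\<nu> cyl_in_Omega\<close>)
        then show ?thesis using pos[of "\<Delta> n - \<Lambda>" \<omega>] fin by (simp add: g_def)
      qed
      then show "AE \<omega> in \<mu>. norm (g n \<omega>) \<le> 1" for n by simp
    qed (use g_meas is_spec_integrable[OF assms(1) \<Lambda> A(1) prob_\<mu> sets_\<mu>] in auto)
    \<comment> \<open>These squares converge to the squared defect of invariance and, by the entropy
      bound, to zero; uniqueness of limits equates the two.\<close>
    then have "(\<lambda>n. (measure \<mu> A - (\<integral>\<omega>. g n \<omega> \<partial>\<mu>))\<^sup>2)
        \<longlonglongrightarrow> (measure \<mu> A - (\<integral>\<omega>. measure (\<gamma> \<Lambda> \<omega>) A \<partial>\<mu>))\<^sup>2"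
      by (intro tendsto_intros)
    moreover have "(\<lambda>n. (measure \<mu> A - (\<integral>\<omega>. g n \<omega> \<partial>\<mu>))\<^sup>2) \<longlonglongrightarrow> 0"
    proof (rule tendsto_sandwich[of "\<lambda>_. 0"])
      have "(measure \<mu> A - (\<integral>\<omega>. g n \<omega> \<partial>\<mu>))\<^sup>2 \<le> 4 * (1 / real (Suc n))" for n
      proof -
        have "(measure \<mu> A - (\<integral>\<omega>. g n \<omega> \<partial>\<mu>))\<^sup>2 \<le> 4 * (ent (\<Delta> n) - ent (\<Delta> n - \<Lambda>))"
          unfolding g_def using sub[of n]
          by (intro conditional_approx_sq_le_ent_diff fin A(1) depends_on_mono[OF A(2)]) auto
        also have "\<dots> \<le> 4 * (1 / real (Suc n))"
          using inc[of n] by (intro mult_left_mono) auto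
        finally show ?thesis .
      qed
      then show "eventually (\<lambda>n. (measure \<mu> A - (\<integral>\<omega>. g n \<omega> \<partial>\<mu>))\<^sup>2 \<le> 4 * (1 / real (Suc n))) sequentially"
        by simp
      show "(\<lambda>n. 4 * (1 / real (Suc n))) \<longlonglongrightarrow> 0"
        using tendsto_mult_right_zero[OF LIMSEQ_inverse_real_of_nat, of 4]
        by (simp add: inverse_eq_divide)
    qed simp_all
    ultimately have "(measure \<mu> A - (\<integral>\<omega>. measure (\<gamma> \<Lambda> \<omega>) A \<partial>\<mu>))\<^sup>2 = 0"
      by (rule LIMSEQ_unique)
    then show "measure \<mu> A = (\<integral>\<omega>. measure (\<gamma> \<Lambda> \<omega>) A \<partial>\<mu>)" by simp
  qed
  with assms(5,7) show ?thesis by (simp add: gibbs_inv_def almost_gibbs_def)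
qed

end
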